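(* Let $Z$ be an exponential random variable with mean one. Let $W\ge 0$ be a random variable with finite second moment, and let $(W,W')$ be an exchangeable pair such that, for some constant $a>0$ and some sigma-field $\mathcal{F}\supseteq\sigma(W)$, $$\mathbb{E}[W'-W\mid\mathcal{F}]=-a(W-1)+R,$$ where $R$ is a random variable (defined by this identity). Then for all twice differentiable functions $h$ with $\|h'\|<\infty$ and $\|h''\|<\infty$, $$|\mathbb{E}h(W)-\mathbb{E}h(Z)|\le 4\|h'\|\,\mathbb{E}\left|W-\frac{\mathbb{E}[(W'-W)^2\mid\mathcal{F}]}{2a}\right|+\|h'\|\,|\mathbb{E}W-1|+\bigl(2(5-6/e)\|h'\|+3\|h''\|\bigr)\frac{\mathbb{E}|W'-W|^3}{4a}+4\|h'\|\,\frac{\mathbb{E}|R|}{a}.$$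
   Context: The pair $(W,W')$ of random variables on a common probability space is exchangeable if $(W,W')$ and $(W',W)$ have the same joint distribution. The test functions $h$ are real-valued functions on $[0,\infty)$ (with one-sided derivatives at $0$), and $\|\cdot\|$ denotes the supremum norm over $[0,\infty)$. *)

theory Defs
  imports "HOL-Probability.Probability"
begin

definition exchangeable_pair :: "'a measure \<Rightarrow> ('a \<Rightarrow> real) \<Rightarrow> ('a \<Rightarrow> real) \<Rightarrow> bool" where
  "exchangeable_pair M X Y \<longleftrightarrow>
     X \<in> borel_measurable M \<and> Y \<in> borel_measurable M \<and>
     distr M (borel \<Otimes>\<^sub>M borel) (\<lambda>\<omega>. (X \<omega>, Y \<omega>)) =
     distr M (borel \<Otimes>\<^sub>M borel) (\<lambda>\<omega>. (Y \<omega>, X \<omega>))"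

(* The test functions live on [0,\<infinity>); as HOL functions on all of real, their values at
   negative arguments are arbitrary and possibly not Borel measurable. For X \<ge> 0 a.s.,
   E h(X) is therefore taken over the event {X \<ge> 0}, which has probability one. *)
definition expectation_nonneg :: "'a measure \<Rightarrow> (real \<Rightarrow> real) \<Rightarrow> ('a \<Rightarrow> real) \<Rightarrow> real" where
  "expectation_nonneg M h X = (LINT \<omega>:{\<omega> \<in> space M. 0 \<le> X \<omega>}|M. h (X \<omega>))"

(* As Sup on real is total, this is the supremum norm only for functions satisfying
   bounded_nonneg. *)
definition sup_norm_nonneg :: "(real \<Rightarrow> real) \<Rightarrow> real" where
  "sup_norm_nonneg f = (SUP x\<in>{0..}. \<bar>f x\<bar>)"

definition bounded_nonneg :: "(real \<Rightarrow> real) \<Rightarrow> bool" where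
  "bounded_nonneg f \<longleftrightarrow> bdd_above ((\<lambda>x. \<bar>f x\<bar>) ` {0..})"

(* The expectation of |X| as an element of [0,\<infinity>], so that infinite moments are not
   silently replaced by 0 as they would be by the Bochner integral. *)
definition abs_expectation :: "'a measure \<Rightarrow> ('a \<Rightarrow> real) \<Rightarrow> ennreal" where
  "abs_expectation M X = (\<integral>\<^sup>+ \<omega>. ennreal \<bar>X \<omega>\<bar> \<partial>M)"

end

theory Submission
  imports Defs "HOL-Real_Asymp.Real_Asymp"
begin

text \<open>
  Stein's method with the operator $x g'(x) - (x - 1) g(x)$. The solution of
  $x g' - (x - 1) g = h - E h(Z)$ is $g(x) = x^{-1} e^x \int_0^x (h(t) - E h(Z)) e^{-t} dt$.
  Differentiating once and twice, $g'$ and $g''$ solve equations of the same kind,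
  $x v' - (x - k) v = r$ with $k = 2, 3$ and bounded $r$, and the integrating factor
  $x^{k-1} e^{-x}$ bounds $v$ by $\sup |r|$; with $L = \sup |h'|$ and $H = \sup |h''|$ this gives
  $|g| \le L$, $|g'| \le 2L$ and $|g''| \le H + 4L$. Exchangeability gives
  $E[(W' - W)(g(W') + g(W))] = 0$; expanding $g(W')$ around $W$ and conditioning on the
  sigma-field turns $E[W g'(W) - (W - 1) g(W)]$ into the three error terms.
  If $E |W' - W|^3$ is infinite, the bound is trivial unless $h$ is constant.
\<close>

text \<open>Two obstacles shape the argument. The right-hand side h - E h(Z) may grow linearly, so g
  cannot be bounded by the supremum of its right-hand side as g' and g'' are. Its bound uses the
  Lipschitz property of h instead: both signs of h - E h(Z), plus L(1 - t), give a decreasing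
  function, and L(1 - t) is the right-hand side whose solution is the constant L. The operator
  degenerates at 0, where W may nevertheless have an atom. Differentiation therefore takes place on
  the open half-line, and the bounds reach 0 by limits. No estimate evaluates an integral: a
  function is compared with an explicit antiderivative of a majorant of its derivative, starting
  from 0 or from infinity. The coefficients obtained are 2L, (H + 4L)/(4a) and L/a. The stated ones
  dominate them, the middle one because e \<ge> 2 gives 2(5 - 6/e) \<ge> 4.\<close>

section \<open>Comparison on the positive half-line through the sign of derivatives\<close>

lemma DERIV_nonneg_limit_at_right_0_le:
  fixes f :: "real \<Rightarrow> real"
  assumes der: "\<And>t. 0 < t \<Longrightarrow> t \<le> x \<Longrightarrow> (f has_real_derivative f' t) (at t)"
    and nonneg: "\<And>t. 0 < t \<Longrightarrow> t \<le> x \<Longrightarrow> 0 \<le> f' t"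
    and lim: "(f \<longlongrightarrow> l) (at_right 0)" and "0 < x"
  shows "l \<le> f x"
proof (rule tendsto_upperbound[OF lim])
  have "eventually (\<lambda>t. t \<in> {0<..<x}) (at_right 0)"
    using \<open>0 < x\<close> by (rule eventually_at_right_real)
  then show "eventually (\<lambda>t. f t \<le> f x) (at_right 0)"
  proof eventually_elim
    case (elim t)
    then have "\<exists>y. (f has_real_derivative y) (at s) \<and> 0 \<le> y" if "t \<le> s" "s \<le> x" for s
      using der[of s] nonneg[of s] that by force
    then show ?case
      using elim by (intro DERIV_nonneg_imp_nondecreasing[of t x f]) auto
  qed
qed simp

lemma DERIV_nonneg_le_limit_at_top:
  fixes f :: "real \<Rightarrow> real"
  assumes der: "\<And>t. x \<le> t \<Longrightarrow> (f has_real_derivative f' t) (at t)"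
    and nonneg: "\<And>t. x \<le> t \<Longrightarrow> 0 \<le> f' t"
    and lim: "(f \<longlongrightarrow> l) at_top"
  shows "f x \<le> l"
proof (rule tendsto_lowerbound[OF lim])
  have "eventually (\<lambda>t. x \<le> t) at_top"
    by (rule eventually_ge_at_top)
  then show "eventually (\<lambda>t. f x \<le> f t) at_top"
  proof eventually_elim
    case (elim t)
    show ?case
    proof (rule DERIV_nonneg_imp_nondecreasing[OF elim])
      show "\<exists>y. (f has_real_derivative y) (at s) \<and> 0 \<le> y" if "x \<le> s" "s \<le> t" for s
        using der[of s] nonneg[of s] that by blast
    qed
  qed
qed simp

text \<open>An antitone \<open>m\<close> changes sign at most once, from plus to minus. So
  \<open>f\<close> first increases from its limit 0 at the origin and then decreases to its limit 0
  at infinity; whichever phase contains \<open>x\<close>, one of the two limits bounds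
  \<open>f x\<close> from below.\<close>

lemma nonneg_of_antimono_derivative:
  fixes f m w :: "real \<Rightarrow> real"
  assumes der: "\<And>t. 0 < t \<Longrightarrow> (f has_real_derivative w t * m t) (at t)"
    and w: "\<And>t. 0 < t \<Longrightarrow> 0 \<le> w t"
    and anti: "\<And>s t. 0 < s \<Longrightarrow> s \<le> t \<Longrightarrow> m t \<le> m s"
    and lim0: "(f \<longlongrightarrow> 0) (at_right 0)" and lim_top: "(f \<longlongrightarrow> 0) at_top" and "0 < x"
  shows "0 \<le> f x"
proof (cases "0 \<le> m x")
  case True
  show ?thesis
  proof (rule DERIV_nonneg_limit_at_right_0_le[OF _ _ lim0 \<open>0 < x\<close>])
    show "(f has_real_derivative w t * m t) (at t)" if "0 < t" for t
      using der[OF that] .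
    show "0 \<le> w t * m t" if "0 < t" "t \<le> x" for t
      using w[OF that(1)] anti[OF that] True by simp
  qed
next
  case False
  have "- f x \<le> 0"
  proof (rule DERIV_nonneg_le_limit_at_top[of x "\<lambda>t. - f t"])
    show "((\<lambda>t. - f t) has_real_derivative - (w t * m t)) (at t)" if "x \<le> t" for t
      using der[of t] that \<open>0 < x\<close> by (auto intro!: derivative_intros)
    show "0 \<le> - (w t * m t)" if "x \<le> t" for t
      using w[of t] anti[OF \<open>0 < x\<close> that] that False \<open>0 < x\<close>
      by (simp add: mult_nonneg_nonpos)
    show "((\<lambda>t. - f t) \<longlongrightarrow> 0) at_top"
      using tendsto_minus[OF lim_top] by simp
  qed
  then show ?thesis by simp
qed

text \<open>Both \<open>F + f\<close> and \<open>F - f\<close> are nondecreasing. The two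
  conclusions replace the estimates of \<open>f\<close> by the integral of \<open>F'\<close> over
  (0, x) and over (x, \<infinity>), with the integrals expressed through limits of
  \<open>F\<close>.\<close>

lemma abs_le_of_abs_deriv_le:
  fixes f F :: "real \<Rightarrow> real"
  assumes f: "\<And>t. 0 < t \<Longrightarrow> (f has_real_derivative f' t) (at t)"
    and F: "\<And>t. 0 < t \<Longrightarrow> (F has_real_derivative F' t) (at t)"
    and le: "\<And>t. 0 < t \<Longrightarrow> \<bar>f' t\<bar> \<le> F' t" and "0 < x"
  shows abs_le_diff_limit_at_right_0:
      "(f \<longlongrightarrow> 0) (at_right 0) \<Longrightarrow> (F \<longlongrightarrow> l) (at_right 0) \<Longrightarrow> \<bar>f x\<bar> \<le> F x - l"
    and abs_le_diff_limit_at_top: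
      "(f \<longlongrightarrow> 0) at_top \<Longrightarrow> (F \<longlongrightarrow> u) at_top \<Longrightarrow> \<bar>f x\<bar> \<le> u - F x"
proof -
  have der: "((\<lambda>t. F t + f t) has_real_derivative F' t + f' t) (at t)"
      "((\<lambda>t. F t - f t) has_real_derivative F' t - f' t) (at t)" if "0 < t" for t
    using f[OF that] F[OF that] by (auto intro!: derivative_intros)
  have nonneg: "0 \<le> F' t + f' t" "0 \<le> F' t - f' t" if "0 < t" for t
    using le[OF that] by auto
  show "\<bar>f x\<bar> \<le> F x - l" if "(f \<longlongrightarrow> 0) (at_right 0)" "(F \<longlongrightarrow> l) (at_right 0)"
  proof -
    have "l + 0 \<le> F x + f x"
      by (rule DERIV_nonneg_limit_at_right_0_le[OF der(1) nonneg(1) _ \<open>0 < x\<close>])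
        (use tendsto_add[OF that(2,1)] in simp_all)
    moreover have "l - 0 \<le> F x - f x"
      by (rule DERIV_nonneg_limit_at_right_0_le[OF der(2) nonneg(2) _ \<open>0 < x\<close>])
        (use tendsto_diff[OF that(2,1)] in simp_all)
    ultimately show ?thesis by auto
  qed
  show "\<bar>f x\<bar> \<le> u - F x" if "(f \<longlongrightarrow> 0) at_top" "(F \<longlongrightarrow> u) at_top"
  proof -
    have "F x + f x \<le> u + 0"
      by (rule DERIV_nonneg_le_limit_at_top[of x "\<lambda>t. F t + f t" "\<lambda>t. F' t + f' t"])
        (use der(1) nonneg(1) \<open>0 < x\<close> tendsto_add[OF that(2,1)] in simp_all)
    moreover have "F x - f x \<le> u - 0"
      by (rule DERIV_nonneg_le_limit_at_top[of x "\<lambda>t. F t - f t" "\<lambda>t. F' t - f' t"])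
        (use der(2) nonneg(2) \<open>0 < x\<close> tendsto_diff[OF that(2,1)] in simp_all)
    ultimately show ?thesis by auto
  qed
qed

section \<open>Bounds for the equations \<open>x * v' - (x - k) * v = r\<close>\<close>

text \<open>Here k is \<open>Suc n\<close>. The logarithmic derivative of
  \<open>x ^ Suc n * exp (- x)\<close> is k/x - 1, which is exactly what the coefficient -(x - k)
  requires after division by x.\<close>

lemma DERIV_integrating_factor:
  fixes v :: "real \<Rightarrow> real"
  assumes "(v has_real_derivative v') (at x)" and "x * v' - (x - real (Suc n)) * v x = r"
  shows "((\<lambda>x. x ^ Suc n * exp (- x) * v x) has_real_derivative x ^ n * exp (- x) * r) (at x)"
proof -
  have "((\<lambda>x. x ^ Suc n) has_real_derivative real (Suc n) * x ^ n) (at x)"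
    using DERIV_pow[of "Suc n" x] by simp
  moreover have "((\<lambda>x. exp (- x)) has_real_derivative - exp (- x)) (at x)"
    by (auto intro!: derivative_eq_intros)
  ultimately have "((\<lambda>x. x ^ Suc n * exp (- x) * v x) has_real_derivative
      (real (Suc n) * x ^ n * exp (- x) + - exp (- x) * x ^ Suc n) * v x + v' * (x ^ Suc n * exp (- x))) (at x)"
    by (intro DERIV_mult assms(1))
  then show ?thesis
    unfolding assms(2)[symmetric] by (simp add: algebra_simps)
qed

text \<open>
  For \<open>k = 2, 3\<close> the solution is estimated from 0 for small arguments and from infinity for large
  ones; the estimates overlap, and \<open>17/10\<close> and \<open>5/2\<close> are switching points in the overlap.
\<close>

lemma exp_le_quadratic:
  assumes "0 \<le> x" "x \<le> 17/10"
  shows "exp x \<le> 1 + x + (x::real)\<^sup>2"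
proof (cases "x \<le> 1")
  case True
  then show ?thesis using exp_bound[OF assms(1)] by simp
next
  case False
  \<comment> \<open>The derivative of \<open>q\<close> has the sign of x(x - 1), so beyond 1 the
    worst case is the right end of the range, and one numerical check there suffices.\<close>
  define q where "q = (\<lambda>x::real. - ((1 + x + x\<^sup>2) * exp (- x)))"
  have der: "(q has_real_derivative (x\<^sup>2 - x) * exp (- x)) (at x)" for x
    unfolding q_def by (auto intro!: derivative_eq_intros simp: algebra_simps)
  have "q x \<le> q (17/10)"
  proof (rule DERIV_nonneg_imp_nondecreasing[of x "17/10" q])
    show "\<exists>y. (q has_real_derivative y) (at t) \<and> 0 \<le> y" if "x \<le> t" for t
      using der[of t] that False by (intro exI conjI) (auto simp: power2_eq_square)
  qed (use assms in simp)
  moreover have "q (17/10) \<le> - 1"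
  proof -
    \<comment> \<open>Completing 17/10 to the integer 2 reduces the check to the known bound e <
      2.72: e^2 is divided by a Taylor lower bound of exp(3/10). The target 559/100 is 1 + x + x^2
      at x = 17/10.\<close>
    have "exp (17/10) * (1 + 3/10 + (3/10)\<^sup>2/2) \<le> exp (17/10) * exp (3/10::real)"
      using exp_lower_Taylor_quadratic[of "3/10"] by simp
    also have "\<dots> = exp 1 ^ 2"
      using exp_of_nat_mult[of 2 "1::real"] by (simp add: mult_exp_exp)
    also have "\<dots> \<le> (272/100) ^ 2"
      using e_less_272 by (intro power_mono) auto
    finally have "exp (17/10) \<le> (559/100::real)" by (simp add: power2_eq_square)
    then show ?thesis by (simp add: q_def exp_minus field_simps power2_eq_square)
  qed
  ultimately have "q x \<le> - 1" by (rule order_trans)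
  then show ?thesis by (simp add: q_def exp_minus field_simps)
qed

lemma two_exp_le_cubic:
  assumes "0 \<le> x" "x \<le> 5/2"
  shows "2 * exp x \<le> 2 + 2 * x + x\<^sup>2 + (x::real) ^ 3"
proof -
  \<comment> \<open>\<open>q\<close> starts at 2, rises up to x = 2 and falls afterwards. Hence
    \<open>2 \<le> q x\<close> can fail only to the right of 2, and there the value at 5/2 decides;
    it is estimated by completing 5/2 to 3.\<close>
  define q where "q = (\<lambda>x::real. (2 + 2 * x + x\<^sup>2 + x ^ 3) * exp (- x))"
  have der: "(q has_real_derivative x\<^sup>2 * (2 - x) * exp (- x)) (at x)" for x
    unfolding q_def by (auto intro!: derivative_eq_intros simp: algebra_simps power2_eq_square power3_eq_cube)
  have "2 \<le> q x"
  proof (cases "x \<le> 2")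
    case True
    then have "q 0 \<le> q x"
      using assms by (intro DERIV_nonneg_imp_nondecreasing[of 0 x q]) (auto intro!: exI der)
    then show ?thesis by (simp add: q_def)
  next
    case False
    then have "q (5/2) \<le> q x"
      using assms by (intro DERIV_nonpos_imp_nonincreasing[of x "5/2" q])
        (auto intro!: exI der simp: mult_nonneg_nonpos mult_nonpos_nonneg)
    moreover have "2 \<le> q (5/2)"
    proof -
      have "exp (5/2) * (1 + 1/2 + (1/2)\<^sup>2/2) \<le> exp (5/2) * exp (1/2::real)"
        using exp_lower_Taylor_quadratic[of "1/2"] by simp
      also have "\<dots> = exp 1 ^ 3"
        using exp_of_nat_mult[of 3 "1::real"] by (simp add: mult_exp_exp)
      also have "\<dots> \<le> (272/100) ^ 3"
        using e_less_272 by (intro power_mono) auto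
      finally have "exp (5/2) \<le> (14::real)" by (simp add: power2_eq_square power3_eq_cube)
      then show ?thesis by (simp add: q_def exp_minus field_simps power2_eq_square power3_eq_cube)
    qed
    ultimately show ?thesis by simp
  qed
  then show ?thesis by (simp add: q_def exp_minus field_simps)
qed

text \<open>The vanishing limits make \<open>x ^ 2 * exp (- x) * v x\<close> both the integral of t
  exp(-t) r(t) over (0, x) and minus its integral over (x, \<infinity>). Up to the factor
  \<open>C\<close>, these are at most 1 - (1 + x) exp(-x) and (1 + x) exp(-x). The first is at most
  x^2 exp(-x) by \<open>exp_le_quadratic\<close>; the second is so as soon as 1 + x \<le> x^2, that
  is, from the golden ratio on, which is below 17/10.\<close>

lemma abs_le_of_ode_2:
  fixes v r :: "real \<Rightarrow> real"
  assumes der: "\<And>t. 0 < t \<Longrightarrow> (v has_real_derivative v' t) (at t)"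
    and ode: "\<And>t. 0 < t \<Longrightarrow> t * v' t - (t - 2) * v t = r t"
    and r: "\<And>t. 0 < t \<Longrightarrow> \<bar>r t\<bar> \<le> C"
    and lim0: "((\<lambda>t. t ^ 2 * exp (- t) * v t) \<longlongrightarrow> 0) (at_right 0)"
    and lim_top: "((\<lambda>t. t ^ 2 * exp (- t) * v t) \<longlongrightarrow> 0) at_top" and "0 < x"
  shows "\<bar>v x\<bar> \<le> C"
proof -
  have "0 \<le> C" using r[OF \<open>0 < x\<close>] by simp
  define F where "F t = - C * (1 + t) * exp (- t)" for t
  have f: "((\<lambda>t. t ^ 2 * exp (- t) * v t) has_real_derivative t * exp (- t) * r t) (at t)" if "0 < t" for t
    using DERIV_integrating_factor[OF der[OF that], of 1] ode[OF that] by (simp add: numeral_2_eq_2)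
  have F: "(F has_real_derivative C * t * exp (- t)) (at t)" for t
    unfolding F_def by (auto intro!: derivative_eq_intros simp: algebra_simps)
  have le: "\<bar>t * exp (- t) * r t\<bar> \<le> C * t * exp (- t)" if "0 < t" for t
    using r[OF that] that by (simp add: abs_mult mult_ac mult_left_mono)
  have lims: "(F \<longlongrightarrow> - C) (at_right 0)" "(F \<longlongrightarrow> 0) at_top"
    unfolding F_def by real_asymp+
  have *: "\<bar>x ^ 2 * exp (- x) * v x\<bar> \<le> F x - (- C)"
    by (rule abs_le_diff_limit_at_right_0[OF f F le \<open>0 < x\<close> lim0 lims(1)])
  have **: "\<bar>x ^ 2 * exp (- x) * v x\<bar> \<le> 0 - F x"
    by (rule abs_le_diff_limit_at_top[OF f F le \<open>0 < x\<close> lim_top lims(2)])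
  have "\<bar>x ^ 2 * exp (- x) * v x\<bar> \<le> C * (x ^ 2 * exp (- x))"
  proof (cases "x \<le> 17/10")
    case True
    have "1 - (1 + x) * exp (- x) \<le> x ^ 2 * exp (- x)"
      using mult_right_mono[OF exp_le_quadratic[of x], of "exp (- x)"] True \<open>0 < x\<close>
      by (simp add: distrib_right mult.assoc mult_exp_exp)
    then have "C * (1 - (1 + x) * exp (- x)) \<le> C * (x ^ 2 * exp (- x))"
      using \<open>0 \<le> C\<close> by (rule mult_left_mono)
    then have "F x - (- C) \<le> C * (x ^ 2 * exp (- x))"
      by (simp add: F_def algebra_simps)
    then show ?thesis using * ** by linarith
  next
    case False
    then have "(17/10) * x \<le> x * x" by (intro mult_right_mono) auto
    then have "C * (1 + x) \<le> C * x\<^sup>2"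
      using False \<open>0 \<le> C\<close> unfolding power2_eq_square by (intro mult_left_mono) linarith+
    then have "C * (1 + x) * exp (- x) \<le> C * x\<^sup>2 * exp (- x)"
      by (rule mult_right_mono) simp
    then have "0 - F x \<le> C * (x ^ 2 * exp (- x))"
      by (simp add: F_def mult.assoc)
    then show ?thesis using * ** by linarith
  qed
  then show ?thesis using \<open>0 < x\<close> by (simp add: abs_mult mult.commute)
qed

text \<open>The same two-sided comparison with weight t^2 exp(-t), whose total mass 2 appears in the
  limit of \<open>F\<close> at 0. From infinity the requirement is 2 + 2x + x^2 \<le> x^3, which
  holds from about 2.27 on; below 5/2, \<open>two_exp_le_cubic\<close> serves the comparison from
  0.\<close>

lemma abs_le_of_ode_3:
  fixes v r :: "real \<Rightarrow> real"
  assumes der: "\<And>t. 0 < t \<Longrightarrow> (v has_real_derivative v' t) (at t)"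
    and ode: "\<And>t. 0 < t \<Longrightarrow> t * v' t - (t - 3) * v t = r t"
    and r: "\<And>t. 0 < t \<Longrightarrow> \<bar>r t\<bar> \<le> C"
    and lim0: "((\<lambda>t. t ^ 3 * exp (- t) * v t) \<longlongrightarrow> 0) (at_right 0)"
    and lim_top: "((\<lambda>t. t ^ 3 * exp (- t) * v t) \<longlongrightarrow> 0) at_top" and "0 < x"
  shows "\<bar>v x\<bar> \<le> C"
proof -
  have "0 \<le> C" using r[OF \<open>0 < x\<close>] by simp
  define F where "F t = - C * (2 + 2 * t + t\<^sup>2) * exp (- t)" for t
  have f: "((\<lambda>t. t ^ 3 * exp (- t) * v t) has_real_derivative t ^ 2 * exp (- t) * r t) (at t)" if "0 < t" for t
    using DERIV_integrating_factor[OF der[OF that], of 2] ode[OF that] by (simp add: numeral_3_eq_3)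
  have F: "(F has_real_derivative C * t ^ 2 * exp (- t)) (at t)" for t
    unfolding F_def by (auto intro!: derivative_eq_intros simp: algebra_simps)
  have le: "\<bar>t ^ 2 * exp (- t) * r t\<bar> \<le> C * t ^ 2 * exp (- t)" if "0 < t" for t
    using r[OF that] that by (simp add: abs_mult mult_ac mult_left_mono)
  have lims: "(F \<longlongrightarrow> - (2 * C)) (at_right 0)" "(F \<longlongrightarrow> 0) at_top"
    unfolding F_def by real_asymp+
  have *: "\<bar>x ^ 3 * exp (- x) * v x\<bar> \<le> F x - (- (2 * C))"
    by (rule abs_le_diff_limit_at_right_0[OF f F le \<open>0 < x\<close> lim0 lims(1)])
  have **: "\<bar>x ^ 3 * exp (- x) * v x\<bar> \<le> 0 - F x"
    by (rule abs_le_diff_limit_at_top[OF f F le \<open>0 < x\<close> lim_top lims(2)])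
  have "\<bar>x ^ 3 * exp (- x) * v x\<bar> \<le> C * (x ^ 3 * exp (- x))"
  proof (cases "x \<le> 5/2")
    case True
    have "2 - (2 + 2 * x + x\<^sup>2) * exp (- x) \<le> x ^ 3 * exp (- x)"
      using mult_right_mono[OF two_exp_le_cubic[of x], of "exp (- x)"] True \<open>0 < x\<close>
      by (simp add: distrib_right mult.assoc mult_exp_exp)
    then have "C * (2 - (2 + 2 * x + x\<^sup>2) * exp (- x)) \<le> C * (x ^ 3 * exp (- x))"
      using \<open>0 \<le> C\<close> by (rule mult_left_mono)
    then have "F x - (- (2 * C)) \<le> C * (x ^ 3 * exp (- x))"
      by (simp add: F_def algebra_simps)
    then show ?thesis using * ** by linarith
  next
    case False
    then have "(5/2) * x \<le> x * x" "(5/2) * (x * x) \<le> x * (x * x)"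
      by (intro mult_right_mono; simp)+
    then have "C * (2 + 2 * x + x\<^sup>2) \<le> C * x ^ 3"
      using False \<open>0 \<le> C\<close> unfolding power2_eq_square power3_eq_cube mult.assoc
      by (intro mult_left_mono) linarith+
    then have "C * (2 + 2 * x + x\<^sup>2) * exp (- x) \<le> C * x ^ 3 * exp (- x)"
      by (rule mult_right_mono) simp
    then have "0 - F x \<le> C * (x ^ 3 * exp (- x))"
      by (simp add: F_def mult.assoc)
    then show ?thesis using * ** by linarith
  qed
  then show ?thesis using \<open>0 < x\<close> by (simp add: abs_mult mult.commute)
qed

section \<open>The Stein equation of the exponential law: solution and bounds\<close>

text \<open>The intermediate point of the Lagrange remainder lies between \<open>x\<close> and
  \<open>y\<close> and is thus positive, so derivatives on the open half-line are enough.\<close>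

lemma taylor_second_order_bound:
  fixes f f' f'' :: "real \<Rightarrow> real"
  assumes f: "\<And>t. 0 < t \<Longrightarrow> (f has_real_derivative f' t) (at t)"
    and f': "\<And>t. 0 < t \<Longrightarrow> (f' has_real_derivative f'' t) (at t)"
    and B: "\<And>t. 0 < t \<Longrightarrow> \<bar>f'' t\<bar> \<le> B" and "0 < x" "0 < y"
  shows "\<bar>f y - f x - f' x * (y - x)\<bar> \<le> B / 2 * (y - x)\<^sup>2"
proof (cases "y = x")
  case False
  define D where "D n = (if n = 0 then f else if n = 1 then f' else f'')" for n :: nat
  obtain t where t: "if y < x then y < t \<and> t < x else x < t \<and> t < y"
    and eq: "f y = (\<Sum>m<2. D m x / fact m * (y - x) ^ m) + D 2 t / fact 2 * (y - x) ^ 2"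
  proof (rule exE[OF Taylor[of 2 D f "min x y" "max x y" x y]])
    show "\<forall>m t. m < 2 \<and> min x y \<le> t \<and> t \<le> max x y \<longrightarrow> (D m has_real_derivative D (Suc m) t) (at t)"
      using f f' \<open>0 < x\<close> \<open>0 < y\<close> by (auto simp: D_def less_2_cases_iff)
  qed (use False in \<open>auto simp: D_def\<close>)
  have "0 < t" using t \<open>0 < x\<close> \<open>0 < y\<close> by (auto split: if_splits)
  have "f y - f x - f' x * (y - x) = f'' t / 2 * (y - x)\<^sup>2"
    using eq by (simp add: D_def numeral_2_eq_2)
  also have "\<bar>\<dots>\<bar> \<le> B / 2 * (y - x)\<^sup>2"
    using B[OF \<open>0 < t\<close>] by (auto simp: abs_mult intro!: mult_right_mono)
  finally show ?thesis .
qed simp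

lemma lipschitz_of_deriv_bound_nonneg:
  fixes h h' :: "real \<Rightarrow> real"
  assumes h: "\<And>t. 0 \<le> t \<Longrightarrow> (h has_real_derivative h' t) (at t within {0..})"
    and L: "\<And>t. 0 \<le> t \<Longrightarrow> \<bar>h' t\<bar> \<le> L" and "0 \<le> x" "0 \<le> y"
  shows "\<bar>h y - h x\<bar> \<le> L * \<bar>y - x\<bar>"
proof -
  have "norm (h y - h x) \<le> L * norm (y - x)"
    by (rule field_differentiable_bound[of "{0..}" h h']) (use assms in simp_all)
  then show ?thesis by simp
qed

lemma tendsto_null_of_bound_pos:
  fixes f b :: "real \<Rightarrow> real"
  assumes bound: "\<And>t. 0 < t \<Longrightarrow> norm (f t) \<le> b t"
  shows "(b \<longlongrightarrow> 0) (at_right 0) \<Longrightarrow> (f \<longlongrightarrow> 0) (at_right 0)"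
    and "(b \<longlongrightarrow> 0) at_top \<Longrightarrow> (f \<longlongrightarrow> 0) at_top"
  using bound
  by (auto intro!: Lim_null_comparison[of f b] eventually_mono[OF eventually_at_right_less[of 0]]
      eventually_mono[OF eventually_gt_at_top[of 0]])

text \<open>The hypothesis \<open>mean\<close> identifies \<open>c\<close> as the exponential mean
  of \<open>h\<close>; it makes the numerator of the solution vanish at infinity, without which the
  solution would grow like exp(x)/x. The function \<open>p\<close> plays the role of g'. The second
  derivative enters only through a Taylor remainder, because such an inequality is preserved by
  limits and so remains available at the endpoint 0.\<close>

lemma stein_equation_exponential:
  fixes h h' h'' :: "real \<Rightarrow> real" and c L H :: real
  assumes h: "\<And>t. 0 \<le> t \<Longrightarrow> (h has_real_derivative h' t) (at t within {0..})"
    and h': "\<And>t. 0 \<le> t \<Longrightarrow> (h' has_real_derivative h'' t) (at t within {0..})"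
    and L: "\<And>t. 0 \<le> t \<Longrightarrow> \<bar>h' t\<bar> \<le> L" and H: "\<And>t. 0 \<le> t \<Longrightarrow> \<bar>h'' t\<bar> \<le> H"
    and mean: "((\<lambda>x. integral {0..x} (\<lambda>t. exp (- t) * (h t - c))) \<longlongrightarrow> 0) at_top"
  shows "\<exists>g p :: real \<Rightarrow> real. g \<in> borel_measurable borel \<and> p \<in> borel_measurable borel
    \<and> (\<forall>x\<ge>0. x * p x - (x - 1) * g x = h x - c)
    \<and> (\<forall>x\<ge>0. \<bar>g x\<bar> \<le> L) \<and> (\<forall>x\<ge>0. \<bar>p x\<bar> \<le> 2 * L)
    \<and> (\<forall>x\<ge>0. \<forall>y\<ge>0. \<bar>g y - g x - p x * (y - x)\<bar> \<le> (H + 4 * L) / 2 * (y - x)\<^sup>2)"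
proof -
  define q where "q t = exp (- t) * (h t - c)" for t
  define \<phi> where "\<phi> x = integral {0..x} q" for x
  have cont_h: "continuous_on {0..} h"
    using h by (intro DERIV_continuous_on) auto
  then have cont_q: "continuous_on {0..} q"
    unfolding q_def by (intro continuous_intros)
  have h_at: "(h has_real_derivative h' t) (at t)" "(h' has_real_derivative h'' t) (at t)" if "0 < t" for t
    using h[of t] h'[of t] that by (simp_all add: at_within_interior[of t "{0..}"])
  \<comment> \<open>The interval ending at \<open>t + 1\<close> has every positive \<open>t\<close>
    in its interior, and for \<open>t = 0\<close> it gives the one-sided derivative. One application
    of the fundamental theorem thus covers both cases.\<close>
  have \<phi>_within: "(\<phi> has_real_derivative q t) (at t within {0..t + 1})" if "0 \<le> t" for t
    unfolding \<phi>_def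
    by (rule integral_has_real_derivative) (use that cont_q in \<open>auto intro: continuous_on_subset\<close>)
  have \<phi>: "(\<phi> has_real_derivative q t) (at t)" if "0 < t" for t
    using \<phi>_within[of t] that by (simp add: at_within_interior[of t "{0..t + 1}"])
  have \<phi>0: "\<phi> 0 = 0" by (simp add: \<phi>_def)
  have at_right_0: "at_right 0 = at 0 within {0..1::real}"
    by (metis at_within_Icc_at_right zero_less_one)
  have \<phi>_quot: "((\<lambda>x. \<phi> x / x) \<longlongrightarrow> h 0 - c) (at_right 0)"
    using \<phi>_within[of 0] unfolding at_right_0 by (simp add: has_field_derivative_iff \<phi>0 q_def)
  have \<phi>_lim0: "(\<phi> \<longlongrightarrow> 0) (at_right 0)"
    using DERIV_continuous[OF \<phi>_within[of 0]] unfolding at_right_0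
    by (simp add: continuous_within \<phi>0)
  have \<phi>_top: "(\<phi> \<longlongrightarrow> 0) at_top"
    using mean unfolding \<phi>_def q_def .
  have lip: "\<bar>h y - h x\<bar> \<le> L * \<bar>y - x\<bar>" if "0 \<le> x" "0 \<le> y" for x y
    by (rule lipschitz_of_deriv_bound_nonneg[OF h L that])

  \<comment> \<open>The value \<open>h 0 - c\<close> is the limit of the quotient at 0 and is also
    forced by the equation at x = 0. Being constant off the open half-line, on which it is
    continuous, \<open>g\<close> is Borel measurable. The formulas for \<open>d\<close> and
    \<open>d2\<close> come from solving the equation and its derivative for the highest-order term,
    so they give g' and g'' on the open half-line.\<close>
  define g where "g x = (if x \<in> {0<..} then exp x * \<phi> x / x else h 0 - c)" for x
  define d where "d x = (h x - c + (x - 1) * g x) / x" for x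
  define d2 where "d2 x = (h' x + g x + (x - 2) * d x) / x" for x
  have g_lim0: "(g \<longlongrightarrow> g 0) (at_right 0)"
  proof -
    have "((\<lambda>x. exp x * (\<phi> x / x)) \<longlongrightarrow> exp 0 * (h 0 - c)) (at_right 0)"
      by (intro tendsto_intros \<phi>_quot)
    moreover have "eventually (\<lambda>x. exp x * (\<phi> x / x) = g x) (at_right 0)"
      by (auto simp: g_def eventually_at_right_less intro: eventually_mono[OF eventually_at_right_less])
    ultimately have "(g \<longlongrightarrow> exp 0 * (h 0 - c)) (at_right 0)"
      by (rule Lim_transform_eventually)
    then show ?thesis by (simp add: g_def)
  qed

  have g_bound: "\<bar>g x\<bar> \<le> L" if "0 < x" for x
  proof -
    \<comment> \<open>The term \<open>L * x * exp (- x)\<close> is the antiderivative of L(1 - t)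
      exp(-t), the integrand belonging to the constant solution L. With the Lipschitz constant
      \<open>L\<close> of \<open>h\<close>, the weight \<open>m\<close> below is decreasing for
      either sign \<open>s\<close>.\<close>
    have bound: "0 \<le> s * \<phi> x + L * x * exp (- x)" if s: "\<bar>s\<bar> = 1" for s
    proof (rule nonneg_of_antimono_derivative[where x = x
          and f = "\<lambda>x. s * \<phi> x + L * x * exp (- x)" and w = "\<lambda>t. exp (- t)"
          and m = "\<lambda>t. s * (h t - c) + L * (1 - t)"])
      show "((\<lambda>x. s * \<phi> x + L * x * exp (- x)) has_real_derivative
          exp (- t) * (s * (h t - c) + L * (1 - t))) (at t)" if "0 < t" for t
        using \<phi>[OF that] by (auto intro!: derivative_eq_intros simp: q_def algebra_simps)
      show "s * (h u - c) + L * (1 - u) \<le> s * (h t - c) + L * (1 - t)" if "0 < t" "t \<le> u" for t u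
      proof -
        have "s * (h u - h t) \<le> \<bar>h u - h t\<bar>"
          using s by (auto simp: abs_if split: if_splits)
        also have "\<dots> \<le> L * (u - t)" using lip[of t u] that by simp
        finally show ?thesis by (simp add: algebra_simps)
      qed
      have "((\<lambda>x. L * x * exp (- x)) \<longlongrightarrow> 0) (at_right 0)" "((\<lambda>x. L * x * exp (- x)) \<longlongrightarrow> 0) at_top"
        by real_asymp+
      then show "((\<lambda>x. s * \<phi> x + L * x * exp (- x)) \<longlongrightarrow> 0) (at_right 0)"
        "((\<lambda>x. s * \<phi> x + L * x * exp (- x)) \<longlongrightarrow> 0) at_top"
        using tendsto_add[OF tendsto_mult_left[OF \<phi>_lim0, of s]]
          tendsto_add[OF tendsto_mult_left[OF \<phi>_top, of s]] by force+
    qed (use \<open>0 < x\<close> in auto)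
    have "\<bar>\<phi> x\<bar> \<le> L * x * exp (- x)"
      using bound[of 1] bound[of "- 1"] by auto
    then have "exp x * \<bar>\<phi> x\<bar> \<le> exp x * (L * x * exp (- x))"
      by (rule mult_left_mono) simp
    also have "\<dots> = L * x" by (simp add: exp_minus)
    finally show ?thesis
      using that by (simp add: g_def abs_mult pos_divide_le_eq)
  qed
  have g0_bound: "\<bar>g 0\<bar> \<le> L"
  proof (rule tendsto_upperbound[OF tendsto_rabs[OF g_lim0]])
    show "eventually (\<lambda>x. \<bar>g x\<bar> \<le> L) (at_right 0)"
      using g_bound by (auto intro: eventually_mono[OF eventually_at_right_less])
  qed simp

  have g_der: "(g has_real_derivative d t) (at t)" if "0 < t" for t
  proof -
    have "((\<lambda>x. exp x * \<phi> x / x) has_real_derivative d t) (at t)"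
      using \<phi>[OF that] that
      by (auto intro!: derivative_eq_intros simp: d_def g_def q_def field_simps mult_exp_exp)
    then show ?thesis
      by (rule has_field_derivative_transform_within_open[of _ _ _ "{0<..}"])
        (use that in \<open>auto simp: g_def\<close>)
  qed
  have d_der: "(d has_real_derivative d2 t) (at t)" if "0 < t" for t
  proof -
    have "((h t - c + (t - 1) * g t) / t) = d t" by (simp add: d_def)
    then have gt: "h t - c + (t - 1) * g t = d t * t" using that by (simp add: field_simps)
    show ?thesis unfolding d_def[abs_def] d2_def
      using h_at(1)[OF that] g_der[OF that] that gt
      by (auto intro!: derivative_eq_intros simp: field_simps)
  qed
  have d2_der: "(d2 has_real_derivative (h'' t + 2 * d t + (t - 3) * d2 t) / t) (at t)" if "0 < t" for t
  proof -
    have gt: "h' t + g t + (t - 2) * d t = d2 t * t" using that by (simp add: field_simps d2_def)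
    show ?thesis unfolding d2_def[abs_def]
      using h_at(2)[OF that] g_der[OF that] d_der[OF that] that gt
      by (auto intro!: derivative_eq_intros simp: field_simps)
  qed

  have "0 \<le> L" "0 \<le> H" using L[of 0] H[of 0] by auto
  define A where "A = \<bar>h 0 - c\<bar>"
  have h_bound: "\<bar>h x - c\<bar> \<le> A + L * x" if "0 < x" for x
    using lip[of 0 x] that by (auto simp: A_def)
  have d_bound: "\<bar>d x\<bar> \<le> 2 * L" if "0 < x" for x
  proof (rule abs_le_of_ode_2[where x = x, OF d_der _ _ _ _ that])
    show "t * d2 t - (t - 2) * d t = h' t + g t" if "0 < t" for t
      using that by (simp add: d2_def)
    show "\<bar>h' t + g t\<bar> \<le> 2 * L" if "0 < t" for t
      using L[of t] g_bound[of t] that by linarith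
    \<comment> \<open>A crude bound suffices for the boundary limits: the quotient defining
      \<open>d\<close> costs one power of t, and the remaining one vanishes at 0, while exp(-t)
      absorbs the polynomial growth at infinity.\<close>
    have *: "norm (t ^ 2 * exp (- t) * d t) \<le> t * exp (- t) * (A + L * t + (t + 1) * L)" if "0 < t" for t
    proof -
      have "\<bar>h t - c + (t - 1) * g t\<bar> \<le> \<bar>h t - c\<bar> + \<bar>t - 1\<bar> * \<bar>g t\<bar>"
        by (metis abs_mult abs_triangle_ineq)
      also have "\<dots> \<le> A + L * t + (t + 1) * L"
        using h_bound[OF that] g_bound[OF that] that by (intro add_mono mult_mono) auto
      finally have "t * exp (- t) * \<bar>h t - c + (t - 1) * g t\<bar> \<le> t * exp (- t) * (A + L * t + (t + 1) * L)"
        using that by (intro mult_left_mono) auto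
      then show ?thesis
        using that by (simp add: d_def abs_mult power2_eq_square)
    qed
    have "((\<lambda>t. t * exp (- t) * (A + L * t + (t + 1) * L)) \<longlongrightarrow> 0) (at_right 0)"
      "((\<lambda>t. t * exp (- t) * (A + L * t + (t + 1) * L)) \<longlongrightarrow> 0) at_top"
      by real_asymp+
    then show "((\<lambda>t. t ^ 2 * exp (- t) * d t) \<longlongrightarrow> 0) (at_right 0)"
      "((\<lambda>t. t ^ 2 * exp (- t) * d t) \<longlongrightarrow> 0) at_top"
      by (auto intro: tendsto_null_of_bound_pos[OF *])
  qed
  have d2_bound: "\<bar>d2 x\<bar> \<le> H + 4 * L" if "0 < x" for x
  proof (rule abs_le_of_ode_3[OF d2_der _ _ _ _ that])
    show "t * ((h'' t + 2 * d t + (t - 3) * d2 t) / t) - (t - 3) * d2 t = h'' t + 2 * d t" if "0 < t" for t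
      using that by simp
    show "\<bar>h'' t + 2 * d t\<bar> \<le> H + 4 * L" if "0 < t" for t
      using H[of t] d_bound[of t] that by linarith
    \<comment> \<open>The bound on \<open>d\<close> just proved enters here, so the bracket grows
      only linearly and two powers of t remain at 0.\<close>
    have *: "norm (t ^ 3 * exp (- t) * d2 t) \<le> t\<^sup>2 * exp (- t) * (2 * L + (t + 2) * (2 * L))" if "0 < t" for t
    proof -
      have "\<bar>h' t + g t + (t - 2) * d t\<bar> \<le> \<bar>h' t + g t\<bar> + \<bar>t - 2\<bar> * \<bar>d t\<bar>"
        by (metis abs_mult abs_triangle_ineq)
      also have "\<dots> \<le> 2 * L + (t + 2) * (2 * L)"
        using L[of t] g_bound[OF that] d_bound[OF that] that
        by (intro add_mono mult_mono) (auto simp: abs_le_iff)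
      finally have "t\<^sup>2 * exp (- t) * \<bar>h' t + g t + (t - 2) * d t\<bar> \<le> t\<^sup>2 * exp (- t) * (2 * L + (t + 2) * (2 * L))"
        using that by (intro mult_left_mono) auto
      then show ?thesis
        using that by (simp add: d2_def abs_mult power2_eq_square power3_eq_cube)
    qed
    have "((\<lambda>t. t\<^sup>2 * exp (- t) * (2 * L + (t + 2) * (2 * L))) \<longlongrightarrow> 0) (at_right 0)"
      "((\<lambda>t. t\<^sup>2 * exp (- t) * (2 * L + (t + 2) * (2 * L))) \<longlongrightarrow> 0) at_top"
      by real_asymp+
    then show "((\<lambda>t. t ^ 3 * exp (- t) * d2 t) \<longlongrightarrow> 0) (at_right 0)"
      "((\<lambda>t. t ^ 3 * exp (- t) * d2 t) \<longlongrightarrow> 0) at_top"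
      by (auto intro: tendsto_null_of_bound_pos[OF *])
  qed
  have taylor: "\<bar>g y - g x - d x * (y - x)\<bar> \<le> (H + 4 * L) / 2 * (y - x)\<^sup>2" if "0 < x" "0 < y" for x y
    by (rule taylor_second_order_bound[OF g_der d_der d2_bound that])

  \<comment> \<open>Bolzano-Weierstrass yields a sequence \<open>s\<close> of positive numbers
    tending to 0 along which \<open>d\<close> converges. The bound on \<open>p\<close> and the
    Taylor inequality are carried to the endpoint along this sequence.\<close>
  have "bounded (range (\<lambda>n. d (1 / real (Suc n))))"
    using d_bound by (auto simp: bounded_iff intro!: exI[of _ "2 * L"])
  from bounded_imp_convergent_subsequence[OF this] obtain d0 r
    where r: "strict_mono r" and d0: "((\<lambda>n. d (1 / real (Suc n))) \<circ> r) \<longlonglongrightarrow> d0" by blast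
  define s where "s n = 1 / real (Suc (r n))" for n
  have s_pos: "0 < s n" for n by (simp add: s_def)
  have s0: "s \<longlonglongrightarrow> 0"
    using LIMSEQ_subseq_LIMSEQ[OF LIMSEQ_inverse_real_of_nat r]
    by (simp add: s_def[abs_def] o_def inverse_eq_divide)
  have ds: "(\<lambda>n. d (s n)) \<longlonglongrightarrow> d0"
    using d0 by (simp add: o_def s_def)
  have "filterlim s (at_right 0) sequentially"
    using s0 s_pos less_imp_neq[OF s_pos, symmetric] by (simp add: filterlim_at)
  then have gs: "(\<lambda>n. g (s n)) \<longlonglongrightarrow> g 0"
    by (rule filterlim_compose[OF g_lim0])
  \<comment> \<open>Any accumulation point of \<open>d\<close> at 0 can serve as \<open>g'(0)\<close>, so the limit itself is not needed.\<close>
  define p where "p x = (if x \<in> {0<..} then d x else d0)" for x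

  show ?thesis
  proof (rule exI[of _ g], rule exI[of _ p], intro conjI allI impI)
    have "continuous_on {0<..} g"
      using g_der by (intro continuous_at_imp_continuous_on ballI) (auto intro: DERIV_isCont)
    then have "continuous_on {0<..} (\<lambda>x. exp x * \<phi> x / x)"
      by (rule continuous_on_eq) (simp add: g_def)
    then show "g \<in> borel_measurable borel"
      unfolding g_def[abs_def] by (intro borel_measurable_continuous_on_if) auto
    have "continuous_on {0<..} d"
      using d_der by (intro continuous_at_imp_continuous_on ballI) (auto intro: DERIV_isCont)
    then show "p \<in> borel_measurable borel"
      unfolding p_def[abs_def] by (intro borel_measurable_continuous_on_if) auto
    \<comment> \<open>At x = 0 the factor x removes \<open>p\<close> and leaves
      \<open>g 0 = h 0 - c\<close>.\<close>
    show "x * p x - (x - 1) * g x = h x - c" if "0 \<le> x" for x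
      using that by (cases "x = 0") (auto simp: p_def d_def, simp add: g_def)
    show "\<bar>g x\<bar> \<le> L" if "0 \<le> x" for x
      using that g_bound g0_bound by (cases "x = 0") auto
    show "\<bar>p x\<bar> \<le> 2 * L" if "0 \<le> x" for x
    proof (cases "x = 0")
      case True
      have "\<bar>d0\<bar> \<le> 2 * L"
        by (rule LIMSEQ_le_const2[OF tendsto_rabs[OF ds]]) (use d_bound s_pos in auto)
      then show ?thesis by (simp add: p_def True)
    qed (use that d_bound in \<open>auto simp: p_def\<close>)
    show "\<bar>g y - g x - p x * (y - x)\<bar> \<le> (H + 4 * L) / 2 * (y - x)\<^sup>2" if xy: "0 \<le> x" "0 \<le> y" for x y
    proof (cases "0 < x")
      case x: True
      show ?thesis
      proof (cases "0 < y")
        case False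
        then have "y = 0" using xy by simp
        have "(\<lambda>n. (H + 4 * L) / 2 * (s n - x)\<^sup>2) \<longlonglongrightarrow> (H + 4 * L) / 2 * (0 - x)\<^sup>2"
          "(\<lambda>n. \<bar>g (s n) - g x - d x * (s n - x)\<bar>) \<longlonglongrightarrow> \<bar>g 0 - g x - d x * (0 - x)\<bar>"
          by (intro tendsto_intros s0 gs)+
        from LIMSEQ_le[OF this(2,1)] show ?thesis
          using taylor[OF x s_pos] x by (simp add: p_def \<open>y = 0\<close>)
      qed (use taylor x in \<open>auto simp: p_def\<close>)
    next
      case False
      then have "x = 0" using xy by simp
      show ?thesis
      proof (cases "0 < y")
        case True
        have "(\<lambda>n. (H + 4 * L) / 2 * (y - s n)\<^sup>2) \<longlonglongrightarrow> (H + 4 * L) / 2 * (y - 0)\<^sup>2"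
          "(\<lambda>n. \<bar>g y - g (s n) - d (s n) * (y - s n)\<bar>) \<longlonglongrightarrow> \<bar>g y - g 0 - d0 * (y - 0)\<bar>"
          by (intro tendsto_intros s0 gs ds)+
        from LIMSEQ_le[OF this(2,1)] show ?thesis
          using taylor[OF s_pos True] by (simp add: p_def \<open>x = 0\<close>)
      qed (use xy in \<open>auto simp: \<open>x = 0\<close>\<close>)
    qed
  qed
qed

section \<open>Centering under the exponential law\<close>

text \<open>Connects the truncated Lebesgue integral, for which convergence at infinity is known,
  with the gauge integral over a compact interval, to which the fundamental theorem of calculus was
  applied.\<close>

lemma integral_indicator_scaleR_eq_integral_Icc:
  fixes k :: "real \<Rightarrow> real"
  assumes "integrable lborel (\<lambda>t. indicator {0..} t * k t)"
  shows "(LINT t|lborel. indicator {..x} t *\<^sub>R (indicator {0..} t * k t)) = integral {0..x} k"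
proof -
  have eq: "indicator {..x} t *\<^sub>R (indicator {0..} t * k t) = indicator {0..x} t *\<^sub>R k t" for t :: real
    by (auto simp: indicator_def)
  have "integrable lborel (\<lambda>t. indicator {..x} t *\<^sub>R (indicator {0..} t * k t))"
    by (intro integrable_mult_indicator assms) simp
  then have "set_integrable lborel {0..x} k"
    unfolding eq set_integrable_def .
  from set_borel_integral_eq_integral(2)[OF this] show ?thesis
    unfolding eq set_lebesgue_integral_def .
qed

lemma exponential_distributed_AE_nonneg:
  assumes "distributed M lborel Z (\<lambda>x. ennreal (exponential_density l x))" "0 < l"
  shows "AE \<omega> in M. 0 \<le> Z \<omega>"
proof -
  have "AE x in density lborel (\<lambda>x. ennreal (exponential_density l x)). 0 \<le> x"
    using distributed_borel_measurable[OF assms(1)]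
    by (subst AE_density) (auto simp: exponential_density_def)
  then have "AE x in distr M lborel Z. 0 \<le> x"
    unfolding distributed_distr_eq_density[OF assms(1)] .
  then show ?thesis
    using distributed_measurable[OF assms(1)] by (subst (asm) AE_distr_iff) auto
qed

text \<open>The limit is the expectation of h(Z) minus its own mean. Linear growth gives
  integrability because \<open>Z\<close> has a first moment.\<close>

lemma (in prob_space) exponential_centered_integral_tendsto_0:
  fixes h :: "real \<Rightarrow> real"
  assumes Z: "distributed M lborel Z (\<lambda>x. ennreal (exponential_density 1 x))"
    and cont: "continuous_on {0..} h"
    and growth: "\<And>t. 0 \<le> t \<Longrightarrow> \<bar>h t\<bar> \<le> A + B * t"
  shows "((\<lambda>x. integral {0..x} (\<lambda>t. exp (- t) * (h t - expectation_nonneg M h Z))) \<longlongrightarrow> 0) at_top"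
proof -
  define c where "c = expectation_nonneg M h Z"
  \<comment> \<open>Cutting \<open>h\<close> off at 0 yields a Borel function, whatever
    \<open>h\<close> is at negative arguments, without changing the expectation.\<close>
  define k where "k t = indicator {0..} t * h t" for t :: real
  have [measurable]: "k \<in> borel_measurable borel"
    using borel_measurable_continuous_on_indicator[OF _ cont] by (simp add: k_def[abs_def])
  have [measurable]: "Z \<in> borel_measurable M"
    using distributed_measurable[OF Z] by simp
  have int_Z: "integrable M Z"
    \<comment> \<open>The exponential density is the Erlang density with parameter 0; the last
      argument 1 selects the first moment.\<close>
    using erlang_ith_moment_integrable[of 1 Z 0 1] Z by simp
  have Z_nonneg: "AE \<omega> in M. 0 \<le> Z \<omega>"
    by (rule exponential_distributed_AE_nonneg[OF Z]) simp
  have dens_nonneg: "0 \<le> exponential_density 1 x" for x :: real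
    by (rule exponential_density_nonneg) simp
  have int_k: "integrable M (\<lambda>\<omega>. k (Z \<omega>))"
  proof (rule Bochner_Integration.integrable_bound)
    show "integrable M (\<lambda>\<omega>. A + B * Z \<omega>)" using int_Z by simp
    show "AE \<omega> in M. norm (k (Z \<omega>)) \<le> norm (A + B * Z \<omega>)"
      using Z_nonneg by eventually_elim (use growth in \<open>fastforce simp: k_def\<close>)
  qed simp
  have c: "(LINT \<omega>|M. k (Z \<omega>)) = c"
    unfolding c_def expectation_nonneg_def set_lebesgue_integral_def
    by (intro Bochner_Integration.integral_cong) (auto simp: k_def indicator_def)
  define f where "f t = exponential_density 1 t * (k t - c)" for t
  have f_eq: "f = (\<lambda>t. indicator {0..} t * (exp (- t) * (h t - c)))"
    by (auto simp: f_def k_def exponential_density_def indicator_def)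
  have "integrable lborel f"
    unfolding f_def using int_k by (subst distributed_integrable[OF Z]) (auto simp: dens_nonneg)
  then have "((\<lambda>x. LINT t|lborel. indicator {..x} t *\<^sub>R f t) \<longlongrightarrow> (LINT t|lborel. f t)) at_top"
    by (intro tendsto_integral_at_top) auto
  moreover have "(LINT t|lborel. f t) = 0"
    unfolding f_def using int_k
    by (subst distributed_integral[OF Z]) (auto simp: dens_nonneg c prob_space)
  moreover have "(LINT t|lborel. indicator {..x} t *\<^sub>R f t) = integral {0..x} (\<lambda>t. exp (- t) * (h t - c))" for x
    using \<open>integrable lborel f\<close> unfolding f_eq by (rule integral_indicator_scaleR_eq_integral_Icc)
  ultimately show ?thesis by (simp add: c_def)
qed

section \<open>Consequences of exchangeability\<close>

lemma exchangeable_pair_integral_swap: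
  fixes f :: "real \<Rightarrow> real \<Rightarrow> real"
  assumes "exchangeable_pair M X Y" and [measurable]: "case_prod f \<in> borel_measurable (borel \<Otimes>\<^sub>M borel)"
  shows "(LINT \<omega>|M. f (X \<omega>) (Y \<omega>)) = (LINT \<omega>|M. f (Y \<omega>) (X \<omega>))"
    and "integrable M (\<lambda>\<omega>. f (X \<omega>) (Y \<omega>)) \<longleftrightarrow> integrable M (\<lambda>\<omega>. f (Y \<omega>) (X \<omega>))"
proof -
  have [measurable]: "X \<in> borel_measurable M" "Y \<in> borel_measurable M"
    and eq: "distr M (borel \<Otimes>\<^sub>M borel) (\<lambda>\<omega>. (X \<omega>, Y \<omega>)) = distr M (borel \<Otimes>\<^sub>M borel) (\<lambda>\<omega>. (Y \<omega>, X \<omega>))"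
    using assms(1) by (auto simp: exchangeable_pair_def)
  show "(LINT \<omega>|M. f (X \<omega>) (Y \<omega>)) = (LINT \<omega>|M. f (Y \<omega>) (X \<omega>))"
    using arg_cong[OF eq, of "\<lambda>D. integral\<^sup>L D (case_prod f)"] by (simp add: integral_distr)
  show "integrable M (\<lambda>\<omega>. f (X \<omega>) (Y \<omega>)) \<longleftrightarrow> integrable M (\<lambda>\<omega>. f (Y \<omega>) (X \<omega>))"
    using arg_cong[OF eq, of "\<lambda>D. integrable D (case_prod f)"] by (simp add: integrable_distr_eq)
qed

lemma exchangeable_pair_AE_swap:
  assumes "exchangeable_pair M X Y"
    and [measurable]: "Measurable.pred (borel \<Otimes>\<^sub>M borel) (case_prod P)"
  shows "(AE \<omega> in M. P (X \<omega>) (Y \<omega>)) \<longleftrightarrow> (AE \<omega> in M. P (Y \<omega>) (X \<omega>))"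
proof -
  have [measurable]: "X \<in> borel_measurable M" "Y \<in> borel_measurable M"
    and eq: "distr M (borel \<Otimes>\<^sub>M borel) (\<lambda>\<omega>. (X \<omega>, Y \<omega>)) = distr M (borel \<Otimes>\<^sub>M borel) (\<lambda>\<omega>. (Y \<omega>, X \<omega>))"
    using assms(1) by (auto simp: exchangeable_pair_def)
  show ?thesis
    using arg_cong[OF eq, of "\<lambda>D. AE z in D. case_prod P z"] by (simp add: AE_distr_iff)
qed

section \<open>The error bound under a finite third moment\<close>

text \<open>With the third moment finite, every quantity is a real number and Bochner integrals can
  be split freely. The two integrability claims serve to translate the real integrals into extended
  expectations afterwards.\<close>

lemma exponential_approximation_bound:
  fixes M F :: "'a measure" and N :: "'b measure"
    and W W' R :: "'a \<Rightarrow> real" and Z :: "'b \<Rightarrow> real"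
    and a L H :: real and h h' h'' :: "real \<Rightarrow> real"
  assumes "prob_space M" "prob_space N"
    and Z: "distributed N lborel Z (\<lambda>x. ennreal (exponential_density 1 x))"
    and exch: "exchangeable_pair M W W'"
    and W_nonneg: "AE \<omega> in M. 0 \<le> W \<omega>"
    and W2: "integrable M (\<lambda>\<omega>. (W \<omega>)\<^sup>2)"
    and "a > 0"
    and sub: "subalgebra M F"
    and WF: "W \<in> borel_measurable F"
    and R[measurable]: "R \<in> borel_measurable M"
    and reg: "AE \<omega> in M. real_cond_exp M F (\<lambda>\<omega>. W' \<omega> - W \<omega>) \<omega> = - a * (W \<omega> - 1) + R \<omega>"
    and h: "\<And>t. 0 \<le> t \<Longrightarrow> (h has_real_derivative h' t) (at t within {0..})"
    and h': "\<And>t. 0 \<le> t \<Longrightarrow> (h' has_real_derivative h'' t) (at t within {0..})"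
    and L: "\<And>t. 0 \<le> t \<Longrightarrow> \<bar>h' t\<bar> \<le> L" and H: "\<And>t. 0 \<le> t \<Longrightarrow> \<bar>h'' t\<bar> \<le> H"
    and D3: "integrable M (\<lambda>\<omega>. \<bar>W' \<omega> - W \<omega>\<bar> ^ 3)"
  defines "Q \<equiv> real_cond_exp M F (\<lambda>\<omega>. (W' \<omega> - W \<omega>)\<^sup>2)"
  shows "integrable M (\<lambda>\<omega>. W \<omega> - Q \<omega> / (2 * a))" "integrable M R"
    and "\<bar>expectation_nonneg M h W - expectation_nonneg N h Z\<bar> \<le>
      2 * L * (LINT \<omega>|M. \<bar>W \<omega> - Q \<omega> / (2 * a)\<bar>)
      + (H + 4 * L) * ((LINT \<omega>|M. \<bar>W' \<omega> - W \<omega>\<bar> ^ 3) / (4 * a))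
      + L * ((LINT \<omega>|M. \<bar>R \<omega>\<bar>) / a)"
proof -
  interpret prob_space M by fact
  interpret N: prob_space N by fact
  interpret finite_measure_subalgebra M F using sub by unfold_locales
  have [measurable]: "W \<in> borel_measurable M" "W' \<in> borel_measurable M"
    using exch by (auto simp: exchangeable_pair_def)
  have L0: "0 \<le> L" and H0: "0 \<le> H" using L[of 0] H[of 0] by auto
  have W'_nonneg: "AE \<omega> in M. 0 \<le> W' \<omega>"
    using W_nonneg exchangeable_pair_AE_swap[OF exch, of "\<lambda>x y. 0 \<le> x"] by simp
  have W'2: "integrable M (\<lambda>\<omega>. (W' \<omega>)\<^sup>2)"
    using W2 exchangeable_pair_integral_swap(2)[OF exch, of "\<lambda>x y. x\<^sup>2"] by simp
  have intW: "integrable M W" and intW': "integrable M W'"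
    using W2 W'2 by (auto intro: square_integrable_imp_integrable)
  have D2: "integrable M (\<lambda>\<omega>. (W' \<omega> - W \<omega>)\<^sup>2)"
  proof (rule Bochner_Integration.integrable_bound)
    show "integrable M (\<lambda>\<omega>. 2 * (W' \<omega>)\<^sup>2 + 2 * (W \<omega>)\<^sup>2)" using W2 W'2 by simp
    show "AE \<omega> in M. norm ((W' \<omega> - W \<omega>)\<^sup>2) \<le> norm (2 * (W' \<omega>)\<^sup>2 + 2 * (W \<omega>)\<^sup>2)"
    proof (rule AE_I2)
      fix \<omega>
      have "0 \<le> (W' \<omega> + W \<omega>)\<^sup>2" by simp
      then have "(W' \<omega> - W \<omega>)\<^sup>2 \<le> 2 * (W' \<omega>)\<^sup>2 + 2 * (W \<omega>)\<^sup>2"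
        by (simp add: power2_eq_square algebra_simps)
      then show "norm ((W' \<omega> - W \<omega>)\<^sup>2) \<le> norm (2 * (W' \<omega>)\<^sup>2 + 2 * (W \<omega>)\<^sup>2)"
        by (simp add: order_trans[OF _ abs_ge_self])
    qed
  qed simp
  have intQ: "integrable M Q" unfolding Q_def by (rule real_cond_exp_int(1)[OF D2])
  have [measurable]: "Q \<in> borel_measurable M" using intQ by simp
  show intV: "integrable M (\<lambda>\<omega>. W \<omega> - Q \<omega> / (2 * a))" using intW intQ by simp
  define E where "E = real_cond_exp M F (\<lambda>\<omega>. W' \<omega> - W \<omega>)"
  have intE: "integrable M E" unfolding E_def using intW intW' by (intro real_cond_exp_int(1)) simp
  have "integrable M (\<lambda>\<omega>. E \<omega> + a * (W \<omega> - 1))" using intE intW by simp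
  then show intR: "integrable M R"
    by (rule integrable_cong_AE_imp) (use reg in \<open>auto simp: E_def\<close>)

  have lip: "\<bar>h t\<bar> \<le> \<bar>h 0\<bar> + L * t" if "0 \<le> t" for t
    using lipschitz_of_deriv_bound_nonneg[OF h L, of 0 t] that by simp
  have cont: "continuous_on {0..} h"
    using h by (intro DERIV_continuous_on) auto
  define c where "c = expectation_nonneg N h Z"
  obtain g p :: "real \<Rightarrow> real" where [measurable]: "g \<in> borel_measurable borel" "p \<in> borel_measurable borel"
    and stein: "\<forall>x\<ge>0. x * p x - (x - 1) * g x = h x - c"
    and g: "\<forall>x\<ge>0. \<bar>g x\<bar> \<le> L" and p: "\<forall>x\<ge>0. \<bar>p x\<bar> \<le> 2 * L"
    and taylor: "\<forall>x\<ge>0. \<forall>y\<ge>0. \<bar>g y - g x - p x * (y - x)\<bar> \<le> (H + 4 * L) / 2 * (y - x)\<^sup>2"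
    using stein_equation_exponential[OF h h' L H
        N.exponential_centered_integral_tendsto_0[OF Z cont lip, folded c_def]]
    by blast

  have int_mult: "integrable M (\<lambda>\<omega>. u \<omega> * v \<omega>)"
    if "integrable M v" "u \<in> borel_measurable M" "AE \<omega> in M. \<bar>u \<omega>\<bar> \<le> K" for u v :: "'a \<Rightarrow> real" and K
  proof (rule Bochner_Integration.integrable_bound)
    show "integrable M (\<lambda>\<omega>. K * v \<omega>)" using that by simp
    show "AE \<omega> in M. norm (u \<omega> * v \<omega>) \<le> norm (K * v \<omega>)"
      using that(3) by eventually_elim (auto simp: abs_mult intro!: mult_right_mono)
  qed (use that in measurable)
  have gW: "AE \<omega> in M. \<bar>g (W \<omega>)\<bar> \<le> L" and gW': "AE \<omega> in M. \<bar>g (W' \<omega>)\<bar> \<le> L"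
    and pW: "AE \<omega> in M. \<bar>p (W \<omega>)\<bar> \<le> 2 * L"
    using W_nonneg W'_nonneg g p by auto
  define D where "D \<omega> = W' \<omega> - W \<omega>" for \<omega>
  have [measurable]: "D \<in> borel_measurable M" by (simp add: D_def[abs_def])
  have intD: "integrable M D" using intW intW' by (simp add: D_def[abs_def])
  have intgD: "integrable M (\<lambda>\<omega>. g (W \<omega>) * D \<omega>)" and intg'D: "integrable M (\<lambda>\<omega>. g (W' \<omega>) * D \<omega>)"
    by (intro int_mult[OF intD _ gW] int_mult[OF intD _ gW']; measurable)+
  have intpD2: "integrable M (\<lambda>\<omega>. p (W \<omega>) * (D \<omega>)\<^sup>2)"
    using D2 by (intro int_mult[OF _ _ pW]) (auto simp: D_def)
  have intpV: "integrable M (\<lambda>\<omega>. p (W \<omega>) * (W \<omega> - Q \<omega> / (2 * a)))"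
    by (intro int_mult[OF intV _ pW]) measurable
  have intpQ: "integrable M (\<lambda>\<omega>. p (W \<omega>) * Q \<omega>)"
    by (intro int_mult[OF intQ _ pW]) measurable
  have intgR: "integrable M (\<lambda>\<omega>. g (W \<omega>) * R \<omega>)"
    by (intro int_mult[OF intR _ gW]) measurable
  have intgE: "integrable M (\<lambda>\<omega>. g (W \<omega>) * E \<omega>)"
    using intE by (intro int_mult[OF intE _ gW]) measurable
  have intgW: "integrable M (\<lambda>\<omega>. g (W \<omega>) * (W \<omega> - 1))"
    using intW by (intro int_mult[OF _ _ gW]) measurable

  have anti: "(LINT \<omega>|M. (g (W \<omega>) + g (W' \<omega>)) * D \<omega>) = 0"
  proof -
    have "(LINT \<omega>|M. (g (W \<omega>) + g (W' \<omega>)) * (W' \<omega> - W \<omega>)) = (LINT \<omega>|M. (g (W' \<omega>) + g (W \<omega>)) * (W \<omega> - W' \<omega>))"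
      by (rule exchangeable_pair_integral_swap(1)[OF exch, of "\<lambda>x y. (g x + g y) * (y - x)"]) measurable
    also have "\<dots> = (LINT \<omega>|M. - ((g (W \<omega>) + g (W' \<omega>)) * (W' \<omega> - W \<omega>)))"
      by (intro Bochner_Integration.integral_cong) (auto simp: algebra_simps)
    finally show ?thesis by (simp add: D_def)
  qed
  have condE: "(LINT \<omega>|M. g (W \<omega>) * E \<omega>) = (LINT \<omega>|M. g (W \<omega>) * D \<omega>)"
    unfolding E_def D_def using intgD WF
    by (intro real_cond_exp_intg(2)) (auto simp: D_def)
  have condQ: "(LINT \<omega>|M. p (W \<omega>) * Q \<omega>) = (LINT \<omega>|M. p (W \<omega>) * (D \<omega>)\<^sup>2)"
    unfolding Q_def D_def using intpD2 WF
    by (intro real_cond_exp_intg(2)) (auto simp: D_def)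
  have gE: "(LINT \<omega>|M. g (W \<omega>) * E \<omega>) = - a * (LINT \<omega>|M. g (W \<omega>) * (W \<omega> - 1)) + (LINT \<omega>|M. g (W \<omega>) * R \<omega>)"
  proof -
    have "(LINT \<omega>|M. g (W \<omega>) * E \<omega>) = (LINT \<omega>|M. - a * (g (W \<omega>) * (W \<omega> - 1)) + g (W \<omega>) * R \<omega>)"
    proof (rule integral_cong_AE)
      show "AE \<omega> in M. g (W \<omega>) * E \<omega> = - a * (g (W \<omega>) * (W \<omega> - 1)) + g (W \<omega>) * R \<omega>"
        using reg
      proof eventually_elim
        case (elim \<omega>)
        have "E \<omega> = - a * (W \<omega> - 1) + R \<omega>"
          using elim unfolding E_def .
        then show ?case
          by (simp only:) (simp add: algebra_simps)
      qed
    qed (use intE in measurable)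
    also have "\<dots> = - a * (LINT \<omega>|M. g (W \<omega>) * (W \<omega> - 1)) + (LINT \<omega>|M. g (W \<omega>) * R \<omega>)"
      using intgW intgR by simp
    finally show ?thesis .
  qed
  \<comment> \<open>This is \<open>D\<close> times the first-order Taylor remainder of
    \<open>g\<close>. By the vanishing of E[(g(W) + g(W')) D], the expectation of (g(W') - g(W)) D
    is -2 E[g(W) D], which gives the formula for the integral of \<open>rem\<close>.\<close>
  define rem where "rem \<omega> = (g (W' \<omega>) - g (W \<omega>)) * D \<omega> - p (W \<omega>) * (D \<omega>)\<^sup>2" for \<omega>
  have int_rem: "integrable M rem"
    unfolding rem_def left_diff_distrib using intgD intg'D intpD2 by simp
  have rem: "(LINT \<omega>|M. rem \<omega>) = - 2 * (LINT \<omega>|M. g (W \<omega>) * D \<omega>) - (LINT \<omega>|M. p (W \<omega>) * Q \<omega>)"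
    using anti intgD intg'D intpD2 by (simp add: rem_def[abs_def] left_diff_distrib distrib_right condQ)
  have EhW: "expectation_nonneg M h W - c = (LINT \<omega>|M. W \<omega> * p (W \<omega>) - (W \<omega> - 1) * g (W \<omega>))"
  proof -
    have intpW: "integrable M (\<lambda>\<omega>. p (W \<omega>) * W \<omega>)"
      by (intro int_mult[OF intW _ pW]) measurable
    \<comment> \<open>As \<open>h\<close> need not be measurable at negative arguments,
      measurability is derived from its continuous restriction to the half-line.\<close>
    have meas: "(\<lambda>\<omega>. indicator {\<omega> \<in> space M. 0 \<le> W \<omega>} \<omega> *\<^sub>R h (W \<omega>)) \<in> borel_measurable M"
    proof -
      have [measurable]: "(\<lambda>t. indicator {0..} t *\<^sub>R h t) \<in> borel_measurable borel"
        using borel_measurable_continuous_on_indicator[OF _ cont] by simp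
      have "(\<lambda>\<omega>. (\<lambda>t. indicator {0..} t *\<^sub>R h t) (W \<omega>)) \<in> borel_measurable M" by measurable
      then show ?thesis
        by (rule measurable_cong[THEN iffD1, rotated]) (auto simp: indicator_def)
    qed
    have "expectation_nonneg M h W = (LINT \<omega>|M. (p (W \<omega>) * W \<omega> - g (W \<omega>) * (W \<omega> - 1)) + c)"
      unfolding expectation_nonneg_def set_lebesgue_integral_def
    proof (rule integral_cong_AE[OF meas])
      show "AE \<omega> in M. indicator {\<omega> \<in> space M. 0 \<le> W \<omega>} \<omega> *\<^sub>R h (W \<omega>) = p (W \<omega>) * W \<omega> - g (W \<omega>) * (W \<omega> - 1) + c"
        using W_nonneg AE_space
      proof eventually_elim
        case (elim \<omega>)
        then show ?case using stein elim(1) by (simp add: algebra_simps)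
      qed
    qed measurable
    then show ?thesis
      using intpW intgW by (simp add: prob_space mult.commute)
  qed
  \<comment> \<open>Q/(2a) is inserted next to W. Then E[p(W) Q] = -2 E[g(W) D] - E[rem], while a
    E[g(W)(W - 1)] = E[g(W) R] - E[g(W) D], so the terms with g(W) D cancel and only the three error
    terms remain.\<close>
  also have "\<dots> = (LINT \<omega>|M. p (W \<omega>) * (W \<omega> - Q \<omega> / (2 * a)) + (p (W \<omega>) * Q \<omega>) / (2 * a) - g (W \<omega>) * (W \<omega> - 1))"
    by (intro Bochner_Integration.integral_cong) (auto simp: algebra_simps)
  also have "\<dots> = (LINT \<omega>|M. p (W \<omega>) * (W \<omega> - Q \<omega> / (2 * a))) + (LINT \<omega>|M. p (W \<omega>) * Q \<omega>) / (2 * a)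
      - (LINT \<omega>|M. g (W \<omega>) * (W \<omega> - 1))"
    using intpV intpQ intgW by simp
  also have "\<dots> = (LINT \<omega>|M. p (W \<omega>) * (W \<omega> - Q \<omega> / (2 * a))) - (LINT \<omega>|M. rem \<omega>) / (2 * a)
      - (LINT \<omega>|M. g (W \<omega>) * R \<omega>) / a"
  proof -
    have "a * (LINT \<omega>|M. g (W \<omega>) * (W \<omega> - 1)) = (LINT \<omega>|M. g (W \<omega>) * R \<omega>) - (LINT \<omega>|M. g (W \<omega>) * D \<omega>)"
      using gE condE by simp
    then have eq: "(LINT \<omega>|M. g (W \<omega>) * (W \<omega> - 1)) = ((LINT \<omega>|M. g (W \<omega>) * R \<omega>) - (LINT \<omega>|M. g (W \<omega>) * D \<omega>)) / a"
      using \<open>a > 0\<close> by (simp add: field_simps)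
    then show ?thesis unfolding rem eq using \<open>a > 0\<close> by (simp add: field_simps)
  qed
  finally have decomp: "expectation_nonneg M h W - c = \<dots>" .

  have abs_le: "\<bar>LINT \<omega>|M. u \<omega>\<bar> \<le> K * (LINT \<omega>|M. \<bar>v \<omega>\<bar>)"
    if "integrable M u" "integrable M v" "AE \<omega> in M. \<bar>u \<omega>\<bar> \<le> K * \<bar>v \<omega>\<bar>" for u v :: "'a \<Rightarrow> real" and K
  proof -
    have "\<bar>LINT \<omega>|M. u \<omega>\<bar> \<le> (LINT \<omega>|M. \<bar>u \<omega>\<bar>)" by (rule integral_abs_bound)
    also have "\<dots> \<le> (LINT \<omega>|M. K * \<bar>v \<omega>\<bar>)"
      using that by (intro integral_mono_AE) auto
    finally show ?thesis by simp
  qed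
  have b1: "\<bar>LINT \<omega>|M. p (W \<omega>) * (W \<omega> - Q \<omega> / (2 * a))\<bar> \<le> 2 * L * (LINT \<omega>|M. \<bar>W \<omega> - Q \<omega> / (2 * a)\<bar>)"
    using pW by (intro abs_le intpV intV) (auto simp: abs_mult elim!: eventually_mono intro!: mult_right_mono)
  have b2: "\<bar>LINT \<omega>|M. g (W \<omega>) * R \<omega>\<bar> \<le> L * (LINT \<omega>|M. \<bar>R \<omega>\<bar>)"
    using gW by (intro abs_le intgR intR) (auto simp: abs_mult elim!: eventually_mono intro!: mult_right_mono)
  \<comment> \<open>The quadratic Taylor remainder times \<open>D\<close> produces the third
    absolute moment. Its factor 1/2, together with the division by 2a in the decomposition, is the
    origin of the denominator 4a.\<close>
  have b3: "\<bar>LINT \<omega>|M. rem \<omega>\<bar> \<le> (H + 4 * L) / 2 * (LINT \<omega>|M. \<bar>\<bar>W' \<omega> - W \<omega>\<bar> ^ 3\<bar>)"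
  proof (rule abs_le[OF int_rem D3])
    show "AE \<omega> in M. \<bar>rem \<omega>\<bar> \<le> (H + 4 * L) / 2 * \<bar>\<bar>W' \<omega> - W \<omega>\<bar> ^ 3\<bar>"
      using W_nonneg W'_nonneg
    proof eventually_elim
      case (elim \<omega>)
      have "rem \<omega> = (g (W' \<omega>) - g (W \<omega>) - p (W \<omega>) * D \<omega>) * D \<omega>"
        by (simp add: rem_def algebra_simps power2_eq_square)
      then have "\<bar>rem \<omega>\<bar> \<le> ((H + 4 * L) / 2 * (D \<omega>)\<^sup>2) * \<bar>D \<omega>\<bar>"
        using mult_right_mono[OF taylor[rule_format, OF elim], of "\<bar>D \<omega>\<bar>"]
        by (simp add: abs_mult D_def)
      also have "\<dots> = (H + 4 * L) / 2 * (\<bar>D \<omega>\<bar>\<^sup>2 * \<bar>D \<omega>\<bar>)" by simp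
      finally show ?case by (simp add: D_def power3_eq_cube power2_eq_square abs_mult)
    qed
  qed
  have triangle: "\<bar>x - y / (2 * a) - z / a\<bar> \<le> \<bar>x\<bar> + \<bar>y\<bar> / (2 * a) + \<bar>z\<bar> / a" for x y z :: real
  proof -
    have "\<bar>x - y / (2 * a) - z / a\<bar> \<le> \<bar>x\<bar> + \<bar>y / (2 * a)\<bar> + \<bar>z / a\<bar>"
      by linarith
    then show ?thesis using \<open>a > 0\<close> by (simp add: abs_divide abs_mult)
  qed
  have "\<bar>expectation_nonneg M h W - c\<bar> \<le> \<bar>LINT \<omega>|M. p (W \<omega>) * (W \<omega> - Q \<omega> / (2 * a))\<bar>
      + \<bar>LINT \<omega>|M. rem \<omega>\<bar> / (2 * a) + \<bar>LINT \<omega>|M. g (W \<omega>) * R \<omega>\<bar> / a"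
    unfolding decomp by (rule triangle)
  also have "\<dots> \<le> 2 * L * (LINT \<omega>|M. \<bar>W \<omega> - Q \<omega> / (2 * a)\<bar>)
      + ((H + 4 * L) / 2 * (LINT \<omega>|M. \<bar>W' \<omega> - W \<omega>\<bar> ^ 3)) / (2 * a) + (L * (LINT \<omega>|M. \<bar>R \<omega>\<bar>)) / a"
    using b1 b2 b3 \<open>a > 0\<close> by (intro add_mono divide_right_mono) auto
  finally show "\<bar>expectation_nonneg M h W - expectation_nonneg N h Z\<bar> \<le>
      2 * L * (LINT \<omega>|M. \<bar>W \<omega> - Q \<omega> / (2 * a)\<bar>)
      + (H + 4 * L) * ((LINT \<omega>|M. \<bar>W' \<omega> - W \<omega>\<bar> ^ 3) / (4 * a))
      + L * ((LINT \<omega>|M. \<bar>R \<omega>\<bar>) / a)"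
    by (simp add: c_def)
qed

section \<open>Passage to extended expectations and the stated constants\<close>

lemma (in prob_space) expectation_nonneg_const:
  assumes "X \<in> borel_measurable M" "AE \<omega> in M. 0 \<le> X \<omega>" and h: "\<And>x. 0 \<le> x \<Longrightarrow> h x = k"
  shows "expectation_nonneg M h X = k"
proof -
  have "expectation_nonneg M h X = (LINT \<omega>|M. indicator {\<omega> \<in> space M. 0 \<le> X \<omega>} \<omega> * k)"
    unfolding expectation_nonneg_def set_lebesgue_integral_def
    by (intro Bochner_Integration.integral_cong) (auto simp: indicator_def h)
  also have "\<dots> = (LINT \<omega>|M. k)"
    using assms(1,2) by (intro integral_cong_AE) (auto simp: indicator_def elim!: eventually_mono)
  finally show ?thesis by (simp add: prob_space)
qed

lemma abs_le_sup_norm_nonneg: "bounded_nonneg f \<Longrightarrow> 0 \<le> x \<Longrightarrow> \<bar>f x\<bar> \<le> sup_norm_nonneg f"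
  unfolding sup_norm_nonneg_def bounded_nonneg_def by (rule cSUP_upper) auto

lemma abs_expectation_eq_integral:
  "integrable M X \<Longrightarrow> abs_expectation M X = ennreal (LINT \<omega>|M. \<bar>X \<omega>\<bar>)"
  unfolding abs_expectation_def by (rule nn_integral_eq_integral) auto

theorem theorem2p1:
  fixes M F :: "'a measure" and N :: "'b measure"
    and W W' R :: "'a \<Rightarrow> real" and Z :: "'b \<Rightarrow> real"
    and a :: real and h h' h'' :: "real \<Rightarrow> real"
  assumes "prob_space M" and "prob_space N"
    and "distributed N lborel Z (\<lambda>x. ennreal (exponential_density 1 x))"
    and "exchangeable_pair M W W'"
    and "AE \<omega> in M. 0 \<le> W \<omega>"
    and "integrable M (\<lambda>\<omega>. (W \<omega>)\<^sup>2)"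
    and "a > 0"
    and "subalgebra M F"
    and "sets (vimage_algebra (space M) W borel) \<subseteq> sets F"
    and "R \<in> borel_measurable M"
    and "AE \<omega> in M. real_cond_exp M F (\<lambda>\<omega>. W' \<omega> - W \<omega>) \<omega> = - a * (W \<omega> - 1) + R \<omega>"
    and "\<And>x. 0 \<le> x \<Longrightarrow> (h has_real_derivative h' x) (at x within {0..})"
    and "\<And>x. 0 \<le> x \<Longrightarrow> (h' has_real_derivative h'' x) (at x within {0..})"
    and "bounded_nonneg h'" and "bounded_nonneg h''"
  shows "ennreal \<bar>expectation_nonneg M h W - expectation_nonneg N h Z\<bar>
    \<le> ennreal (4 * sup_norm_nonneg h') *
        abs_expectation M (\<lambda>\<omega>. W \<omega> - real_cond_exp M F (\<lambda>\<omega>. (W' \<omega> - W \<omega>)\<^sup>2) \<omega> / (2 * a))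
      + ennreal (sup_norm_nonneg h' * \<bar>prob_space.expectation M W - 1\<bar>)
      + ennreal (2 * (5 - 6 / exp 1) * sup_norm_nonneg h' + 3 * sup_norm_nonneg h'') *
        (abs_expectation M (\<lambda>\<omega>. (W' \<omega> - W \<omega>) ^ 3) / ennreal (4 * a))
      + ennreal (4 * sup_norm_nonneg h') * (abs_expectation M R / ennreal a)"
proof -
  interpret prob_space M by fact
  interpret N: prob_space N by fact
  note Z = assms(3) and exch = assms(4) and h = assms(12) and h' = assms(13)
  have [measurable]: "W \<in> borel_measurable M" "W' \<in> borel_measurable M"
    using exch by (auto simp: exchangeable_pair_def)
  define L where "L = sup_norm_nonneg h'"
  define H where "H = sup_norm_nonneg h''"
  have L: "\<bar>h' x\<bar> \<le> L" and H: "\<bar>h'' x\<bar> \<le> H" if "0 \<le> x" for x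
    using that abs_le_sup_norm_nonneg assms(14,15) by (auto simp: L_def H_def)
  have L0: "0 \<le> L" and H0: "0 \<le> H" using L[of 0] H[of 0] by auto
  define K where "K = 2 * (5 - 6 / exp 1) * L + 3 * H"
  \<comment> \<open>Since e \<ge> 2, the number 6/e is at most 3, so 2(5 - 6/e) \<ge> 4.\<close>
  have K: "H + 4 * L \<le> K"
  proof -
    have "6 / exp 1 \<le> (3::real)"
      using exp_ge_add_one_self[of 1] by (simp add: field_simps)
    then have "4 * L \<le> 2 * (5 - 6 / exp 1) * L"
      using L0 by (intro mult_right_mono) auto
    then show ?thesis using H0 by (simp add: K_def)
  qed
  have WF: "W \<in> borel_measurable F"
  proof (rule measurableI)
    fix A :: "real set" assume "A \<in> sets borel"
    then have "W -` A \<inter> space M \<in> sets (vimage_algebra (space M) W borel)"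
      by (rule in_vimage_algebra)
    then show "W -` A \<inter> space F \<in> sets F"
      using assms(8,9) by (auto simp: subalgebra_def)
  qed simp
  \<comment> \<open>In the extended reals here 0 times \<infinity> is 0, so an infinite third moment
    makes the bound trivial only if its coefficient \<open>K\<close> is positive. This can fail only
    for L = 0; then \<open>h\<close> is constant on the half-line and the left-hand side is
    0.\<close>
  have "K > 0" if "L \<noteq> 0" using K L0 H0 that by linarith
  then consider "L = 0" | "K > 0" "abs_expectation M (\<lambda>\<omega>. (W' \<omega> - W \<omega>) ^ 3) = \<infinity>"
    | "abs_expectation M (\<lambda>\<omega>. (W' \<omega> - W \<omega>) ^ 3) < \<infinity>"
    by (metis infinity_ennreal_def less_top)
  then show ?thesis
  proof cases
    case 1
    have const: "h x = h 0" if "0 \<le> x" for x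
      using lipschitz_of_deriv_bound_nonneg[OF h L, of 0 x] that by (simp add: 1)
    have "expectation_nonneg M h W = h 0"
      using assms(5) by (intro expectation_nonneg_const const) simp_all
    moreover have "expectation_nonneg N h Z = h 0"
      using distributed_measurable[OF Z] exponential_distributed_AE_nonneg[OF Z]
      by (intro N.expectation_nonneg_const const) simp_all
    ultimately show ?thesis by simp
  next
    case 2
    then have "ennreal K * (abs_expectation M (\<lambda>\<omega>. (W' \<omega> - W \<omega>) ^ 3) / ennreal (4 * a)) = \<infinity>"
      by (simp add: ennreal_top_divide ennreal_mult_top)
    then show ?thesis by (simp add: K_def L_def H_def)
  next
    case 3
    have D3: "integrable M (\<lambda>\<omega>. (W' \<omega> - W \<omega>) ^ 3)"
      using 3 by (intro integrableI_bounded) (auto simp: abs_expectation_def)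
    then have D3': "integrable M (\<lambda>\<omega>. \<bar>W' \<omega> - W \<omega>\<bar> ^ 3)"
      by (auto dest: integrable_abs simp: power_abs)
    define Q where "Q = real_cond_exp M F (\<lambda>\<omega>. (W' \<omega> - W \<omega>)\<^sup>2)"
    define V where "V = (LINT \<omega>|M. \<bar>W \<omega> - Q \<omega> / (2 * a)\<bar>)"
    define T where "T = (LINT \<omega>|M. \<bar>W' \<omega> - W \<omega>\<bar> ^ 3)"
    define S where "S = (LINT \<omega>|M. \<bar>R \<omega>\<bar>)"
    have nonneg: "0 \<le> V" "0 \<le> T" "0 \<le> S" by (simp_all add: V_def T_def S_def)
    note bound = exponential_approximation_bound[OF assms(1-8) WF assms(10,11) h h' L H D3', folded Q_def]
    have "\<bar>expectation_nonneg M h W - expectation_nonneg N h Z\<bar> \<le> 2 * L * V + (H + 4 * L) * (T / (4 * a)) + L * (S / a)"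
      using bound(3) by (simp add: V_def T_def S_def)
    also have "\<dots> \<le> 4 * L * V + L * \<bar>expectation W - 1\<bar> + K * (T / (4 * a)) + 4 * L * (S / a)"
    proof -
      have "2 * L * V \<le> 4 * L * V" "L * (S / a) \<le> 4 * L * (S / a)" "(H + 4 * L) * (T / (4 * a)) \<le> K * (T / (4 * a))"
        using L0 K nonneg \<open>a > 0\<close> by (auto intro!: mult_right_mono simp del: times_divide_eq_right)
      moreover have "0 \<le> L * \<bar>expectation W - 1\<bar>" using L0 by simp
      ultimately show ?thesis by linarith
    qed
    finally have "ennreal \<bar>expectation_nonneg M h W - expectation_nonneg N h Z\<bar> \<le>
        ennreal (4 * L * V + L * \<bar>expectation W - 1\<bar> + K * (T / (4 * a)) + 4 * L * (S / a))"
      by (rule ennreal_leI)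
    also have "\<dots> = ennreal (4 * L) * ennreal V + ennreal (L * \<bar>expectation W - 1\<bar>)
        + ennreal K * (ennreal T / ennreal (4 * a)) + ennreal (4 * L) * (ennreal S / ennreal a)"
    proof -
      have nn: "0 \<le> 4 * L" "0 \<le> K" "0 \<le> T / (4 * a)" "0 \<le> S / a" "0 < 4 * a"
        using L0 H0 K nonneg \<open>a > 0\<close> by auto
      have "0 \<le> 4 * L * V" "0 \<le> L * \<bar>expectation W - 1\<bar>" "0 \<le> K * (T / (4 * a))" "0 \<le> 4 * L * (S / a)"
        using nn(1-4) L0 nonneg by (intro mult_nonneg_nonneg; simp)+
      then show ?thesis
        unfolding divide_ennreal[OF nonneg(2) nn(5)] divide_ennreal[OF nonneg(3) \<open>a > 0\<close>]
          ennreal_mult[OF nn(1) nonneg(1), symmetric] ennreal_mult[OF nn(2,3), symmetric]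
          ennreal_mult[OF nn(1,4), symmetric]
        by (simp only: ennreal_plus add_nonneg_nonneg)
    qed
    finally show ?thesis
      using abs_expectation_eq_integral[OF bound(1)] abs_expectation_eq_integral[OF bound(2)]
        abs_expectation_eq_integral[OF D3]
      by (simp add: K_def L_def H_def V_def T_def S_def Q_def power_abs)
  qed
qed

end
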